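(* Let $A=\{0,1,2,3\}$ and let $P_z,P_e$ be integers with $0\le P_z,P_e\le 9$. Then the language-shift cellular automaton $K:A^{\mathbb{Z}^2}\to A^{\mathbb{Z}^2}$ with parameters $(P_z,P_e)$ has no strictly periodic point; that is, there are no $x\in A^{\mathbb{Z}^2}$ and integer $p\ge 2$ such that $K^p(x)=x$ and $K^i(x)\neq x$ for all $1\le i<p$.
   Context: Let $A=\{0,1,2,3\}$ and let $P_z,P_e$ be integers with $0\le P_z\le 9$ and $0\le P_e\le 9$. For $x\in A^{\mathbb{Z}^2}$ and $(i,j)\in\mathbb{Z}^2$ put $$\Sigma_0(x)_{i,j}=\sum_{r=-1}^{1}\sum_{s=-1}^{1}\left\lfloor \frac{x_{(i+r,j+s)}}{2}\right\rfloor,\qquad \Sigma_1(x)_{i,j}=\sum_{r=-1}^{1}\sum_{s=-1}^{1}\left(x_{(i+r,j+s)}-2\left\lfloor \frac{x_{(i+r,j+s)}}{2}\right\rfloor\right).$$ (So $\Sigma_0$ counts the cells in state $2$ or $3$, and $\Sigma_1$ counts the cells in state $1$ or $3$, in the $3\times 3$ block centered at $(i,j)$, center included.) The language-shift cellular automaton $K$ with parameters $(P_z,P_e)$ is defined, at each $(i,j)\in\mathbb{Z}^2$, by: - if $x_{(i,j)}=0$: $K(x)_{(i,j)}=0$ if $\Sigma_0(x)_{i,j}<P_z$ and $\Sigma_1(x)_{i,j}<P_e$; $=1$ if $\Sigma_0(x)_{i,j}<P_z$ and $\Sigma_1(x)_{i,j}\ge P_e$; $=2$ if $\Sigma_0(x)_{i,j}\ge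 P_z$ and $\Sigma_1(x)_{i,j}<P_e$; $=3$ if $\Sigma_0(x)_{i,j}\ge P_z$ and $\Sigma_1(x)_{i,j}\ge P_e$; - if $x_{(i,j)}=1$: $K(x)_{(i,j)}=3$ if $\Sigma_0(x)_{i,j}\ge P_z$, and $=1$ otherwise; - if $x_{(i,j)}=2$: $K(x)_{(i,j)}=3$ if $\Sigma_1(x)_{i,j}\ge P_e$, and $=2$ otherwise; - if $x_{(i,j)}=3$: $K(x)_{(i,j)}=3$. Here $K^n$ denotes the $n$-fold iterate of $K$. *)

theory Defs
  imports Main "HOL-Library.FuncSet"
begin

definition alphabet :: "int set" where
  "alphabet = {0, 1, 2, 3}"

definition configs :: "(int \<times> int \<Rightarrow> int) set" where
  "configs = UNIV \<rightarrow> alphabet"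

(* On int, div rounds towards minus infinity, so v div 2 is the floor of v / 2. *)
definition Sigma0 :: "(int \<times> int \<Rightarrow> int) \<Rightarrow> int \<times> int \<Rightarrow> int" where
  "Sigma0 x = (\<lambda>(i, j). \<Sum>r = -1..1. \<Sum>s = -1..1. x (i + r, j + s) div 2)"

definition Sigma1 :: "(int \<times> int \<Rightarrow> int) \<Rightarrow> int \<times> int \<Rightarrow> int" where
  "Sigma1 x = (\<lambda>(i, j). \<Sum>r = -1..1. \<Sum>s = -1..1.
     x (i + r, j + s) - 2 * (x (i + r, j + s) div 2))"

(* The last branch is the rule for state 3; its values at cells outside the alphabet
   are irrelevant, since K is only considered on configs. *)
definition K :: "int \<Rightarrow> int \<Rightarrow> (int \<times> int \<Rightarrow> int) \<Rightarrow> int \<times> int \<Rightarrow> int" where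
  "K Pz Pe x = (\<lambda>c.
     if x c = 0 then
       (if Sigma0 x c < Pz \<and> Sigma1 x c < Pe then 0
        else if Sigma0 x c < Pz \<and> Sigma1 x c \<ge> Pe then 1
        else if Sigma0 x c \<ge> Pz \<and> Sigma1 x c < Pe then 2
        else 3)
     else if x c = 1 then (if Sigma0 x c \<ge> Pz then 3 else 1)
     else if x c = 2 then (if Sigma1 x c \<ge> Pe then 3 else 2)
     else 3)"

lemma K_in_configs: "K Pz Pe \<in> configs \<rightarrow> configs"
  by (auto simp: configs_def alphabet_def K_def)

definition strictly_periodic_point :: "('a \<Rightarrow> 'a) \<Rightarrow> 'a \<Rightarrow> bool" where
  "strictly_periodic_point f x \<longleftrightarrow>
     (\<exists>p::nat. p \<ge> 2 \<and> (f ^^ p) x = x \<and> (\<forall>i. 1 \<le> i \<and> i < p \<longrightarrow> (f ^^ i) x \<noteq> x))"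

end

(* A cell never decreases under K, so an orbit that returns to its starting point is constant. *)
theory Submission
  imports Defs
begin

text \<open>In the pointwise order \<open>K\<close> is extensive on \<open>configs\<close>
  (\<open>K_ge\<close>), hence so are its iterates (\<open>funpow_K_ge\<close>). If
  \<open>K^p x = x\<close> with \<open>p \<ge> 2\<close>, then
  \<open>x \<le> K x \<le> K^p x = x\<close>, so \<open>x\<close> is a fixed point, against the
  minimality of \<open>p\<close>.\<close>

lemma K_ge: "x \<in> configs \<Longrightarrow> x \<le> K Pz Pe x"
proof (rule le_funI)
  fix c
  assume "x \<in> configs"
  \<comment> \<open>The bound by 3 matters: the default branch of \<open>K\<close> returns 3, which
    would lower a larger value.\<close>
  then have "x c \<in> {0, 1, 2, 3}"
    unfolding configs_def alphabet_def by blast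
  then show "x c \<le> K Pz Pe x c"
    by (auto simp: K_def)
qed

lemma funpow_K_in_configs: "x \<in> configs \<Longrightarrow> (K Pz Pe ^^ n) x \<in> configs"
  using K_in_configs by (induction n) (auto simp: Pi_iff)

lemma funpow_K_ge: "x \<in> configs \<Longrightarrow> x \<le> (K Pz Pe ^^ n) x"
  by (induction n) (auto intro: order_trans K_ge funpow_K_in_configs)

theorem proposition6:
  fixes Pz Pe :: int
  assumes "0 \<le> Pz" and "Pz \<le> 9" and "0 \<le> Pe" and "Pe \<le> 9"
  shows "\<not> (\<exists>x \<in> configs. strictly_periodic_point (K Pz Pe) x)"
proof
  assume "\<exists>x \<in> configs. strictly_periodic_point (K Pz Pe) x"
  then obtain x p where x: "x \<in> configs" and "p \<ge> 2" and per: "(K Pz Pe ^^ p) x = x"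
    and least: "\<forall>i. 1 \<le> i \<and> i < p \<longrightarrow> (K Pz Pe ^^ i) x \<noteq> x"
    unfolding strictly_periodic_point_def by blast
  from \<open>p \<ge> 2\<close> obtain q where q: "p = Suc q"
    by (cases p) auto
  \<comment> \<open>One step is split off at the inner end of \<open>K^p\<close>, so that
    extensivity of \<open>K^q\<close> applies at \<open>K x\<close>; monotonicity of
    \<open>K\<close> is never invoked.\<close>
  have "K Pz Pe x \<le> (K Pz Pe ^^ q) (K Pz Pe x)"
    using funpow_K_ge K_in_configs x by blast
  also have "\<dots> = x"
    using per by (simp add: q funpow_swap1)
  finally have "K Pz Pe x = x"
    using K_ge[OF x] by (rule order_antisym)
  moreover have "(K Pz Pe ^^ 1) x \<noteq> x"
    using least \<open>p \<ge> 2\<close> by auto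
  ultimately show False
    by simp
qed

end
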